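(* There exists a constant $\delta>0$ such that the following holds. Let $A$ be a real $2\times 2$ matrix of one of the three forms (1) $A=\begin{pmatrix} a&0\\0&d\end{pmatrix}$ with $a,d\in\mathbb{R}$; (2) $A=\begin{pmatrix} a&-d\\ d&a\end{pmatrix}$ with $a,d\in\mathbb{R}$, $d\neq0$, $a^2+(1-d^2)^2\neq0$; (3) $A=\begin{pmatrix} a&d\\0&a\end{pmatrix}$ with $a\in\mathbb{R}$, $d\in\mathbb{R}$, $d\neq0$; and suppose all entries of $A$ have absolute value less than $\delta$. Let $M=(A+iI)\mathbb{R}^2$ and $N=\mathbb{R}^2$ in $\mathbb{C}^2$, let $d_M$ and $d_N$ be the squared Euclidean distance functions to $M$ and $N$ in $\mathbb{C}^2$, and let $$\rho=d_M^{2}d_N+d_Md_N^{2}.$$ Then for every $\epsilon>0$ the sublevel set $\Omega_\epsilon=\{\rho<\epsilon\}$ is strongly Levi pseudoconvex.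
   Context: Coordinates on $\mathbb{C}^2$ are $(z_1,z_2)=(x+iy,u+iv)$; $\mathbb{R}^2$ is identified with $(\mathbb{R}\times\{0\})^2=\{y=v=0\}\subset\mathbb{C}^2$, and $(A+iI)\mathbb{R}^2=\{(A+iI)w: w\in\mathbb{R}^2\}$. Explicitly, $d_N(x,y,u,v)=y^2+v^2$, and $d_M(x,y,u,v)$ equals in form (1): $\frac{(u-dv)^2}{1+d^2}+\frac{(x-ay)^2}{1+a^2}$; in form (2): $\frac{(u-dy-av)^2}{1+a^2+d^2}+\frac{(x-ay+dv)^2}{1+a^2+d^2}$; in form (3): $\frac{(u-av)^2}{1+a^2}+\frac{((1+a^2)(x-ay)-dau-dv)^2}{(1+a^2)((1+a^2)^2+d^2)}$. The Levi form of a $\mathcal{C}^2$ function $\rho$ is $\mathcal{L}_{(z)}(\rho;\lambda)=\sum_{j,k=1}^2\frac{\partial^2\rho}{\partial z_j\partial\bar z_k}(z)\lambda_j\overline{\lambda}_k$. A domain $\Omega=\{\rho<c\}$ with boundary $b\Omega=\{\rho=c\}$, $d\rho\ne0$ on $b\Omega$, is strongly Levi pseudoconvex if $\mathcal{L}_{(z)}(\rho;\lambda)>0$ for every $z\in b\Omega$ and every nonzero $\lambda$ in the complex tangent space $T_z^{\mathbb{C}}(b\Omega)=T_z(b\Omega)\cap iT_z(b\Omega)=\{(w_1,w_2)\in\mathbb{C}^2:\frac{\partial\rho}{\partial z_1}(z)w_1+\frac{\partial\rho}{\partial z_2}(z)w_2=0\}$. *)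

theory Defs
  imports "HOL-Analysis.Analysis"
begin

text \<open>\<open>complex ^ 'n\<close> carries the Hermitian (Euclidean) norm, and as a real vector space
  it has the basis \<open>axis j 1\<close>, \<open>axis j \<i>\<close>, i.e. the directions of the real and the
  imaginary part of the \<open>j\<close>-th coordinate.\<close>

definition wirtinger :: "'n \<Rightarrow> (complex ^ 'n \<Rightarrow> complex) \<Rightarrow> complex ^ 'n \<Rightarrow> complex" where
  "wirtinger j f z =
     (vector_derivative (\<lambda>t. f (z + t *\<^sub>R axis j 1)) (at 0)
      - \<i> * vector_derivative (\<lambda>t. f (z + t *\<^sub>R axis j \<i>)) (at 0)) / 2"

definition wirtinger_bar :: "'n \<Rightarrow> (complex ^ 'n \<Rightarrow> complex) \<Rightarrow> complex ^ 'n \<Rightarrow> complex" where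
  "wirtinger_bar j f z =
     (vector_derivative (\<lambda>t. f (z + t *\<^sub>R axis j 1)) (at 0)
      + \<i> * vector_derivative (\<lambda>t. f (z + t *\<^sub>R axis j \<i>)) (at 0)) / 2"

definition levi_form :: "(complex ^ 'n \<Rightarrow> real) \<Rightarrow> complex ^ 'n \<Rightarrow> complex ^ 'n \<Rightarrow> complex" where
  "levi_form \<rho> z l =
     (\<Sum>j\<in>UNIV. \<Sum>k\<in>UNIV.
        wirtinger j (wirtinger_bar k (\<lambda>w. complex_of_real (\<rho> w))) z * (l $ j) * cnj (l $ k))"

definition C1_function :: "('a::real_normed_vector \<Rightarrow> 'b::real_normed_vector) \<Rightarrow> bool" where
  "C1_function f \<longleftrightarrow>
     (\<exists>D :: 'a \<Rightarrow> 'a \<Rightarrow>\<^sub>L 'b.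
        (\<forall>z. (f has_derivative blinfun_apply (D z)) (at z)) \<and> continuous_on UNIV D)"

definition C2_function :: "('a::real_normed_vector \<Rightarrow> 'b::real_normed_vector) \<Rightarrow> bool" where
  "C2_function f \<longleftrightarrow>
     (\<exists>D :: 'a \<Rightarrow> 'a \<Rightarrow>\<^sub>L 'b.
        (\<forall>z. (f has_derivative blinfun_apply (D z)) (at z)) \<and> C1_function D)"

text \<open>The tangent space at \<open>z\<close> of the level set of \<open>\<rho>\<close> through \<open>z\<close>, where \<open>d\<rho> \<noteq> 0\<close>.\<close>

definition tangent_space :: "(complex ^ 'n \<Rightarrow> real) \<Rightarrow> complex ^ 'n \<Rightarrow> (complex ^ 'n) set" where
  "tangent_space \<rho> z = {w. frechet_derivative \<rho> (at z) w = 0}"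

definition complex_tangent_space ::
  "(complex ^ 'n \<Rightarrow> real) \<Rightarrow> complex ^ 'n \<Rightarrow> (complex ^ 'n) set" where
  "complex_tangent_space \<rho> z = tangent_space \<rho> z \<inter> (\<lambda>w. \<i> *s w) ` tangent_space \<rho> z"

text \<open>The Levi form of a \<open>C\<^sup>2\<close> function is Hermitian, so its values are real; the sums in
  \<^const>\<open>levi_form\<close> are complex numbers, so positivity is spelled out as being real with
  positive real part.\<close>

definition strongly_Levi_pseudoconvex_sublevel :: "(complex ^ 'n \<Rightarrow> real) \<Rightarrow> real \<Rightarrow> bool" where
  "strongly_Levi_pseudoconvex_sublevel \<rho> c \<longleftrightarrow>
     C2_function \<rho> \<and>
     {z. \<rho> z < c} \<noteq> {} \<and> open {z. \<rho> z < c} \<and> connected {z. \<rho> z < c} \<and>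
     frontier {z. \<rho> z < c} = {z. \<rho> z = c} \<and>
     (\<forall>z \<in> frontier {z. \<rho> z < c}. frechet_derivative \<rho> (at z) \<noteq> (\<lambda>h. 0)) \<and>
     (\<forall>z \<in> frontier {z. \<rho> z < c}. \<forall>l \<in> complex_tangent_space \<rho> z.
        l \<noteq> 0 \<longrightarrow> levi_form \<rho> z l \<in> \<real> \<and> Re (levi_form \<rho> z l) > 0)"

definition cvec :: "real ^ 'n \<Rightarrow> complex ^ 'n" where
  "cvec w = (\<chi> i. complex_of_real (w $ i))"

definition real_plane :: "(complex ^ 'n) set" where
  "real_plane = range cvec"

definition totally_real_plane :: "real ^ 'n ^ 'n \<Rightarrow> (complex ^ 'n) set" where
  "totally_real_plane A =
     range (\<lambda>w. (\<chi> i j. complex_of_real (A $ i $ j) + \<i> * mat 1 $ i $ j) *v cvec w)"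

definition sq_dist :: "'a::metric_space set \<Rightarrow> 'a \<Rightarrow> real" where
  "sq_dist S z = (infdist z S)\<^sup>2"

definition rho :: "real ^ 'n ^ 'n \<Rightarrow> complex ^ 'n \<Rightarrow> real" where
  "rho A z =
     (let dM = sq_dist (totally_real_plane A) z; dN = sq_dist real_plane z
      in dM\<^sup>2 * dN + dM * dN\<^sup>2)"

lemma frechet_derivative_wirtinger:
  fixes \<rho> :: "complex ^ 'n \<Rightarrow> real"
  assumes "\<rho> differentiable (at z)"
  shows "frechet_derivative \<rho> (at z) w =
    2 * Re (\<Sum>j\<in>UNIV. wirtinger j (\<lambda>u. complex_of_real (\<rho> u)) z * (w $ j))"
proof -
  let ?D = "frechet_derivative \<rho> (at z)"
  have D: "(\<rho> has_derivative ?D) (at z)"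
    using assms frechet_derivative_works by blast
  interpret D: bounded_linear ?D
    using D by (rule has_derivative_bounded_linear)
  have dir: "vector_derivative (\<lambda>t. complex_of_real (\<rho> (z + t *\<^sub>R v))) (at 0)
      = complex_of_real (?D v)" for v
  proof -
    have 1: "((\<lambda>t. z + t *\<^sub>R v) has_derivative (\<lambda>t. t *\<^sub>R v)) (at 0)"
      by (auto intro!: derivative_eq_intros)
    have "((\<lambda>t. \<rho> (z + t *\<^sub>R v)) has_derivative (\<lambda>t. ?D (t *\<^sub>R v))) (at 0)"
      using has_derivative_compose[OF 1, of \<rho> ?D] D by simp
    then have "((\<lambda>t. complex_of_real (\<rho> (z + t *\<^sub>R v)))
        has_derivative (\<lambda>t. complex_of_real (?D (t *\<^sub>R v)))) (at 0)"
      by (rule has_derivative_of_real)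
    then show ?thesis
      by (intro vector_derivative_at) (simp add: has_vector_derivative_def D.scaleR scaleR_conv_of_real[where 'a = complex])
  qed
  have "w = (\<Sum>j\<in>UNIV. Re (w $ j) *\<^sub>R axis j 1 + Im (w $ j) *\<^sub>R axis j \<i>)"
    by (simp add: vec_eq_iff axis_def complex_eq_iff if_distrib[of "\<lambda>x. _ * x"] if_distrib[of Re]
        if_distrib[of Im] sum.distrib cong: if_cong)
  then have "?D w = ?D (\<Sum>j\<in>UNIV. Re (w $ j) *\<^sub>R axis j 1 + Im (w $ j) *\<^sub>R axis j \<i>)"
    by simp
  also have "\<dots> = (\<Sum>j\<in>UNIV. Re (w $ j) * ?D (axis j 1) + Im (w $ j) * ?D (axis j \<i>))"
    by (simp add: D.sum D.add D.scaleR)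
  also have "\<dots> = 2 * Re (\<Sum>j\<in>UNIV. wirtinger j (\<lambda>u. complex_of_real (\<rho> u)) z * (w $ j))"
    by (simp add: wirtinger_def dir sum_distrib_left algebra_simps add_divide_distrib)
  finally show ?thesis .
qed

lemma complex_tangent_space_eq:
  fixes \<rho> :: "complex ^ 'n \<Rightarrow> real"
  assumes "\<rho> differentiable (at z)"
  shows "complex_tangent_space \<rho> z =
    {w. (\<Sum>j\<in>UNIV. wirtinger j (\<lambda>u. complex_of_real (\<rho> u)) z * (w $ j)) = 0}"
proof -
  let ?S = "\<lambda>w. \<Sum>j\<in>UNIV. wirtinger j (\<lambda>u. complex_of_real (\<rho> u)) z * (w $ j)"
  have T: "w \<in> tangent_space \<rho> z \<longleftrightarrow> Re (?S w) = 0" for w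
    by (simp add: tangent_space_def frechet_derivative_wirtinger[OF assms])
  have mult: "?S (c *s w) = c * ?S w" for c w
    by (simp add: sum_distrib_left mult_ac)
  have "w \<in> (\<lambda>w. \<i> *s w) ` tangent_space \<rho> z \<longleftrightarrow> - \<i> *s w \<in> tangent_space \<rho> z" for w
  proof
    assume "- \<i> *s w \<in> tangent_space \<rho> z"
    moreover have "w = \<i> *s (- \<i> *s w)" by (simp add: vec_eq_iff)
    ultimately show "w \<in> (\<lambda>w. \<i> *s w) ` tangent_space \<rho> z" by blast
  next
    assume "w \<in> (\<lambda>w. \<i> *s w) ` tangent_space \<rho> z"
    then obtain v where v: "v \<in> tangent_space \<rho> z" "w = \<i> *s v" by blast
    then have "- \<i> *s w = v" by (simp add: vec_eq_iff)
    with v show "- \<i> *s w \<in> tangent_space \<rho> z" by simp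
  qed
  moreover have "Re (?S (- \<i> *s w)) = Im (?S w)" for w
    unfolding mult by simp
  ultimately show ?thesis
    unfolding complex_tangent_space_def by (auto simp: T complex_eq_iff)
qed

end

theory Submission
  imports Defs
begin

text \<open>
  Let \<open>Q\<close> and \<open>K\<close> be the real orthogonal projectors onto \<open>M\<^sup>\<bottom>\<close> and \<open>N\<^sup>\<bottom>\<close>. The squared distances
  are \<open>p = |Qz|\<^sup>2\<close> and \<open>q = |Kz|\<^sup>2\<close>, with gradients \<open>2Qz\<close> and \<open>2Kz\<close> of norms \<open>2\<surd>p\<close> and \<open>2\<surd>q\<close>, and the
  defining function is \<open>r = p\<^sup>2q + pq\<^sup>2\<close>. Put \<open>f = \<partial>r/\<partial>p = 2pq + q\<^sup>2\<close> and \<open>g = \<partial>r/\<partial>q = p\<^sup>2 + 2pq\<close>. Half the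
  gradient of \<open>r\<close> is \<open>w = f Qz + g Kz\<close>.

  The argument is entirely real, because the Levi form of \<open>\<rho>\<close> at \<open>l\<close> is a quarter of
  \<open>H(l,l) + H(\<i>l,\<i>l)\<close>, where \<open>H\<close> is the real Hessian (\<open>levi_form_eq_hessian\<close>), and \<open>l\<close> is a complex
  tangent vector exactly if the derivative of \<open>\<rho>\<close> vanishes on \<open>l\<close> and on \<open>\<i>l\<close>. For \<open>h = l\<close> and
  \<open>h = \<i>l\<close>, tangency lets us write \<open>Qz \<bullet> h = g c\<^sub>h\<close> and \<open>Kz \<bullet> h = - f c\<^sub>h\<close>, and then
  \<open>H(h,h) = 2f|Qh|\<^sup>2 + 2g|Kh|\<^sup>2 - 24R c\<^sub>h\<^sup>2\<close> with \<open>R = pq(p + q)(p\<^sup>2 + pq + q\<^sup>2)\<close>. The negative term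
  is controlled by a Gram determinant estimate (\<open>complex_gram_bound\<close>): the sum \<open>n\<close> of the two \<open>c\<^sub>h\<^sup>2\<close>
  satisfies \<open>n |w|\<^sup>2 \<le> pq |l|\<^sup>2\<close>.

  If \<open>A = 0\<close>, then \<open>M = \<i>N\<close>, the vectors \<open>Qz\<close> and \<open>Kz\<close> are orthogonal, so
  \<open>|w|\<^sup>2 = f\<^sup>2p + g\<^sup>2q\<close>, and the positive terms add up to \<open>2(f + g)|l|\<^sup>2\<close>. Positivity is then the
  inequality \<open>12Rpq < (f + g)(f\<^sup>2p + g\<^sup>2q)\<close> for \<open>p, q > 0\<close>. Both sides carry a factor \<open>pq\<close>, and after
  cancelling it the inequality even holds with a factor \<open>6/7\<close> on the right
  (\<open>quintic_inequality\<close>). This slack pays for a perturbation: if \<open>|Aw| \<le> a|w|\<close>, then \<open>M\<^sup>\<bottom>\<close> is so close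
  to \<open>N\<close> that \<open>|w|\<^sup>2 \<ge> (1 - a)(f\<^sup>2p + g\<^sup>2q)\<close> (\<open>gradient_norm_bound\<close>) and
  \<open>|Ql|\<^sup>2 + |Q\<i>l|\<^sup>2 \<ge> (1 - 2a - a\<^sup>2)|l|\<^sup>2\<close> (\<open>projector_half_bound\<close>). All errors are relative, so the estimate
  is uniform up to \<open>M \<union> N\<close> and at infinity, and \<open>a = 1/25\<close> is small enough.

  The remaining requirements follow from \<open>r(tz) = t\<^sup>6 r(z)\<close>: sublevel sets are star-shaped, their
  frontiers are the level sets, and Euler's identity excludes critical points there.
\<close>

section \<open>Orthogonal projectors and distances to subspaces\<close>

definition orthogonal_projector :: "('a::real_inner \<Rightarrow> 'a) \<Rightarrow> bool" where
  "orthogonal_projector Q \<longleftrightarrow>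
     bounded_linear Q \<and> (\<forall>x y. Q x \<bullet> y = x \<bullet> Q y) \<and> (\<forall>x. Q (Q x) = Q x)"

lemma projector_inner:
  assumes "orthogonal_projector Q"
  shows "Q x \<bullet> Q y = Q x \<bullet> y" "x \<bullet> Q y = Q x \<bullet> y"
  using assms unfolding orthogonal_projector_def by metis+

text \<open>Subtracting the expansion in an orthonormal basis of \<open>S\<close> gives the projector.\<close>

lemma orthogonal_projector_onto_complement:
  fixes S :: "'a::euclidean_space set"
  assumes "subspace S"
  obtains Q where "orthogonal_projector Q" "\<And>x. x - Q x \<in> S" "\<And>x y. y \<in> S \<Longrightarrow> Q x \<bullet> y = 0"
proof -
  obtain B where B: "B \<subseteq> S" "pairwise orthogonal B" "\<And>b. b \<in> B \<Longrightarrow> norm b = 1"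
    "independent B" "span B = S"
    using orthonormal_basis_subspace[OF assms] by metis
  have fin: "finite B" using B(4) by (rule independent_imp_finite)
  define P where "P x = (\<Sum>b\<in>B. (x \<bullet> b) *\<^sub>R b)" for x
  have Pb: "P x \<bullet> b = x \<bullet> b" if "b \<in> B" for x b
  proof -
    have "P x \<bullet> b = (\<Sum>c\<in>B. if c = b then x \<bullet> b else 0)"
      unfolding P_def inner_sum_left
      using that B(2,3) by (intro sum.cong) (auto simp: pairwise_def orthogonal_def norm_eq_1)
    then show ?thesis using that fin by simp
  qed
  have PS: "P x \<in> S" for x
    using B(1) assms unfolding P_def by (intro subspace_sum subspace_scale) auto
  have orth: "(x - P x) \<bullet> y = 0" if "y \<in> S" for x y
  proof -
    have "y \<in> span B" using that B(5) by simp
    then have "orthogonal (x - P x) y"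
      by (rule orthogonal_to_span) (simp add: orthogonal_def inner_diff_left Pb)
    then show ?thesis by (simp add: orthogonal_def)
  qed
  have sym: "P x \<bullet> y = x \<bullet> P y" for x y
    using orth[OF PS[of y], of x] orth[OF PS[of x], of y]
    by (simp add: inner_diff_left inner_commute[of "P x"])
  have idem: "P (P x) = P x" for x
  proof -
    have "(\<Sum>b\<in>B. (P x \<bullet> b) *\<^sub>R b) = (\<Sum>b\<in>B. (x \<bullet> b) *\<^sub>R b)"
      by (intro sum.cong) (simp_all add: Pb)
    then show ?thesis by (simp only: P_def[symmetric])
  qed
  have bl: "bounded_linear P"
    unfolding P_def
    by (intro bounded_linear_sum bounded_linear_scaleR_const bounded_linear_inner_left)
  interpret P: bounded_linear P by (rule bl)
  show ?thesis
  proof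
    show "orthogonal_projector (\<lambda>x. x - P x)"
      unfolding orthogonal_projector_def
      by (auto intro!: bounded_linear_sub bl bounded_linear_ident
          simp: inner_diff_left inner_diff_right sym P.diff idem)
  qed (use PS orth in auto)
qed

lemma sq_dist_eq_projector:
  fixes Q :: "'a::real_inner \<Rightarrow> 'a"
  assumes "\<And>x. x - Q x \<in> S" "\<And>x y. y \<in> S \<Longrightarrow> Q x \<bullet> y = 0"
  shows "sq_dist S x = (norm (Q x))\<^sup>2"
proof -
  have ne: "S \<noteq> {}" using assms(1) by blast
  have "norm (Q x) \<le> dist x y" if "y \<in> S" for y
  proof -
    have "dist x y = norm (Q x + (x - Q x - y))" by (simp add: dist_norm)
    moreover have "orthogonal (Q x) (x - Q x - y)"
      using assms(2)[OF assms(1)[of x], of x] assms(2)[OF that, of x]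
      by (simp add: orthogonal_def inner_diff_right)
    ultimately have "(dist x y)\<^sup>2 = (norm (Q x))\<^sup>2 + (norm (x - Q x - y))\<^sup>2"
      by (simp only: norm_add_Pythagorean)
    then show ?thesis by (simp add: power2_le_imp_le)
  qed
  then have "norm (Q x) \<le> infdist x S"
    using ne unfolding infdist_notempty[OF ne] by (intro cINF_greatest) auto
  moreover have "infdist x S \<le> norm (Q x)"
    using infdist_le[OF assms(1), of x x] by (simp add: dist_norm)
  ultimately show ?thesis unfolding sq_dist_def by simp
qed

section \<open>Twice continuously differentiable functions\<close>

lemma C1_bounded_linear:
  assumes "bounded_linear f" shows "C1_function f"
  unfolding C1_function_def
  using assms by (intro exI[of _ "\<lambda>_. Blinfun f"])
    (auto simp: bounded_linear_Blinfun_apply bounded_linear_imp_has_derivative)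

lemma C1_continuous: "C1_function f \<Longrightarrow> continuous_on UNIV f"
  unfolding C1_function_def
  using has_derivative_continuous continuous_at_imp_continuous_on by blast

lemma C2_imp_C1: "C2_function f \<Longrightarrow> C1_function f"
  unfolding C2_function_def C1_function_def[of f] using C1_continuous by blast

lemma C1_add:
  assumes "C1_function f" "C1_function g" shows "C1_function (\<lambda>z. f z + g z)"
proof -
  obtain D E where "\<forall>z. (f has_derivative blinfun_apply (D z)) (at z)" "continuous_on UNIV D"
    "\<forall>z. (g has_derivative blinfun_apply (E z)) (at z)" "continuous_on UNIV E"
    using assms unfolding C1_function_def by blast
  then show ?thesis
    unfolding C1_function_def
    by (intro exI[of _ "\<lambda>z. D z + E z"])
      (auto intro!: continuous_intros derivative_eq_intros simp: blinfun.add_left)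
qed

lemma C1_scaleR:
  fixes g :: "_ \<Rightarrow> 'b::real_normed_vector"
  assumes "C1_function f" "C1_function g" shows "C1_function (\<lambda>z. f z *\<^sub>R g z)"
proof -
  obtain D E where D: "\<And>z. (f has_derivative blinfun_apply (D z)) (at z)" "continuous_on UNIV D"
    and E: "\<And>z. (g has_derivative blinfun_apply (E z)) (at z)" "continuous_on UNIV E"
    using assms unfolding C1_function_def by blast
  define F where "F z = f z *\<^sub>R E z + (blinfun_scaleR_left (g z) o\<^sub>L D z)" for z
  have "((\<lambda>z. f z *\<^sub>R g z) has_derivative blinfun_apply (F z)) (at z)" for z
    by (rule has_derivative_eq_rhs[OF has_derivative_scaleR[OF D(1) E(1)]])
      (simp add: F_def fun_eq_iff blinfun.add_left blinfun.scaleR_left)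
  moreover have "continuous_on UNIV F"
    unfolding F_def
    using C1_continuous[OF assms(1)] C1_continuous[OF assms(2)] D(2) E(2)
    by (auto intro!: continuous_intros bounded_linear.continuous_on[OF bounded_linear_blinfun_scaleR_left])
  ultimately show ?thesis unfolding C1_function_def by blast
qed

lemma C2_add:
  assumes "C2_function f" "C2_function g" shows "C2_function (\<lambda>z. f z + g z)"
proof -
  obtain D E where "\<forall>z. (f has_derivative blinfun_apply (D z)) (at z)" "C1_function D"
    "\<forall>z. (g has_derivative blinfun_apply (E z)) (at z)" "C1_function E"
    using assms unfolding C2_function_def by blast
  then show ?thesis
    unfolding C2_function_def
    by (intro exI[of _ "\<lambda>z. D z + E z"])
      (auto intro!: C1_add derivative_eq_intros simp: blinfun.add_left)
qed

lemma C2_mult: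
  fixes f g :: "_ \<Rightarrow> real"
  assumes "C2_function f" "C2_function g" shows "C2_function (\<lambda>z. f z * g z)"
proof -
  obtain D E where "\<forall>z. (f has_derivative blinfun_apply (D z)) (at z)" "C1_function D"
    "\<forall>z. (g has_derivative blinfun_apply (E z)) (at z)" "C1_function E"
    using assms unfolding C2_function_def by blast
  moreover from this have "C1_function (\<lambda>z. f z *\<^sub>R E z + g z *\<^sub>R D z)"
    using assms by (intro C1_add C1_scaleR) (auto intro: C2_imp_C1)
  ultimately show ?thesis
    unfolding C2_function_def
    by (intro exI[of _ "\<lambda>z. f z *\<^sub>R E z + g z *\<^sub>R D z"])
      (auto intro!: derivative_eq_intros simp: blinfun.add_left blinfun.scaleR_left)
qed

text \<open>The gradient of \<open>|Qz|\<^sup>2\<close> is \<open>2Q\<^sup>TQz\<close>, and \<open>Q\<^sup>TQ = Q\<close> for an orthogonal projector.\<close>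

lemma projector_has_derivative_norm2:
  assumes "orthogonal_projector Q"
  shows "((\<lambda>z. (norm (Q z))\<^sup>2) has_derivative (\<lambda>h. 2 * (Q z \<bullet> h))) (at z)"
proof -
  have "(Q has_derivative Q) (at z)"
    using assms by (auto simp: orthogonal_projector_def intro: bounded_linear_imp_has_derivative)
  from has_derivative_inner[OF this this]
  have "((\<lambda>z. Q z \<bullet> Q z) has_derivative (\<lambda>h. Q z \<bullet> Q h + Q h \<bullet> Q z)) (at z)" .
  moreover have "Q z \<bullet> Q h + Q h \<bullet> Q z = 2 * (Q z \<bullet> h)" for h
    using projector_inner(1)[OF assms, of z h] inner_commute[of "Q h" "Q z"] by linarith
  ultimately show ?thesis by (simp add: power2_norm_eq_inner)
qed

text \<open>The gradient of a quadratic form is a bounded linear map into the dual space, hence itself \<open>C\<^sup>1\<close>.\<close>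

lemma C2_projector_norm2:
  assumes "orthogonal_projector Q"
  shows "C2_function (\<lambda>z. (norm (Q z))\<^sup>2)"
proof -
  have Q: "bounded_linear Q" using assms by (simp add: orthogonal_projector_def)
  have "bounded_linear (\<lambda>z. 2 *\<^sub>R blinfun_inner_right (Q z))"
    by (intro bounded_linear_compose[OF bounded_linear_scaleR_right]
        bounded_linear_compose[OF bounded_linear_blinfun_inner_right] Q)
  moreover have "blinfun_apply (2 *\<^sub>R blinfun_inner_right (Q z)) = (\<lambda>h. 2 * (Q z \<bullet> h))" for z
    by (simp add: fun_eq_iff blinfun.scaleR_left)
  ultimately show ?thesis
    unfolding C2_function_def
    using projector_has_derivative_norm2[OF assms] C1_bounded_linear by metis
qed

section \<open>The Levi form as a mean of the real Hessian\<close>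

lemma inner_imaginary_unit:
  fixes u v :: "complex ^ 'n"
  shows "(\<i> *s u) \<bullet> (\<i> *s v) = u \<bullet> v" "(\<i> *s u) \<bullet> v = - (u \<bullet> (\<i> *s v))" "\<i> *s (\<i> *s u) = - u"
    "norm (\<i> *s u) = norm u" "u \<bullet> (\<i> *s u) = 0"
proof -
  show 1: "(\<i> *s u) \<bullet> (\<i> *s v) = u \<bullet> v" for u v :: "complex ^ 'n"
    by (simp add: inner_vec_def inner_complex_def add.commute)
  show "(\<i> *s u) \<bullet> v = - (u \<bullet> (\<i> *s v))"
    by (simp add: inner_vec_def inner_complex_def sum_negf[symmetric])
  show "\<i> *s (\<i> *s u) = - u" by (simp add: vec_eq_iff)
  show "norm (\<i> *s u) = norm u" by (simp add: norm_eq_sqrt_inner 1)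
  show "u \<bullet> (\<i> *s u) = 0"
    by (simp add: inner_vec_def inner_complex_def mult.commute)
qed

lemma vector_derivative_along_line:
  assumes "(f has_derivative f') (at z)"
  shows "vector_derivative (\<lambda>t. f (z + t *\<^sub>R v)) (at 0) = f' v"
proof -
  have 1: "((\<lambda>t. z + t *\<^sub>R v) has_derivative (\<lambda>t. t *\<^sub>R v)) (at 0)"
    by (auto intro!: derivative_eq_intros)
  have "((\<lambda>t. f (z + t *\<^sub>R v)) has_derivative (\<lambda>t. f' (t *\<^sub>R v))) (at 0)"
    using has_derivative_compose[OF 1, of f f'] assms by simp
  then show ?thesis
    using linear_scale[OF has_derivative_linear[OF assms]]
    by (intro vector_derivative_at) (simp add: has_vector_derivative_def)
qed

text \<open>Written in the real basis \<open>axis j 1\<close>, \<open>axis j \<i>\<close>, the sesquilinear sum in the Levi form is a quarter of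
  \<open>H(l,l) + H(\<i>l,\<i>l) + \<i>(H(l,\<i>l) - H(\<i>l,l))\<close>, and the last bracket vanishes for symmetric \<open>H\<close>.\<close>

lemma levi_form_eq_hessian:
  fixes \<rho> :: "complex ^ 'n \<Rightarrow> real" and l :: "complex ^ 'n"
  assumes D: "\<And>w. (\<rho> has_derivative D w) (at w)"
    and H: "\<And>v. ((\<lambda>w. D w v) has_derivative (\<lambda>u. H u v)) (at z)"
    and sym: "\<And>u v. H u v = H v u"
  shows "levi_form \<rho> z l = complex_of_real ((H l l + H (\<i> *s l) (\<i> *s l)) / 4)"
proof -
  define e f :: "'n \<Rightarrow> complex ^ 'n" where "e j = axis j 1" and "f j = axis j \<i>" for j
  have linl: "linear (\<lambda>u. H u v)" for v using H by (rule has_derivative_linear)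
  have linr: "linear (H u)" for u
    using linl[of u] by (subst sym[abs_def]) simp
  have bar: "wirtinger_bar k (\<lambda>w. complex_of_real (\<rho> w)) w = (D w (e k) + \<i> * D w (f k)) / 2" for k w
    unfolding wirtinger_bar_def e_def f_def
    by (simp add: vector_derivative_along_line[OF has_derivative_of_real[OF D]])
  have dbar: "((\<lambda>w. (complex_of_real (D w (e k)) + \<i> * D w (f k)) / 2) has_derivative
      (\<lambda>u. (complex_of_real (H u (e k)) + \<i> * H u (f k)) / 2)) (at z)" for k
    using H[of "e k"] H[of "f k"] by (auto intro!: derivative_eq_intros)
  have C: "wirtinger j (wirtinger_bar k (\<lambda>w. complex_of_real (\<rho> w))) z =
     (complex_of_real (H (e j) (e k) + H (f j) (f k)) + \<i> * (H (e j) (f k) - H (f j) (e k))) / 4"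
    for j k
    unfolding wirtinger_def bar e_def[symmetric] f_def[symmetric]
    unfolding vector_derivative_along_line[OF dbar] by (simp add: field_simps)
  define x y where "x j = Re (l $ j) *\<^sub>R e j + Im (l $ j) *\<^sub>R f j"
    and "y j = Re (l $ j) *\<^sub>R f j - Im (l $ j) *\<^sub>R e j" for j
  have l: "l = (\<Sum>j\<in>UNIV. x j)"
    by (simp add: x_def e_def f_def vec_eq_iff axis_def complex_eq_iff if_distrib[of "\<lambda>x. _ * x"]
        if_distrib[of Re] if_distrib[of Im] sum.distrib cong: if_cong)
  have il: "\<i> *s l = (\<Sum>j\<in>UNIV. y j)"
    by (simp add: y_def e_def f_def vec_eq_iff axis_def complex_eq_iff if_distrib[of "\<lambda>x. _ * x"]
        if_distrib[of Re] if_distrib[of Im] sum.distrib sum_subtractf cong: if_cong)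
  have HS: "H (\<Sum>j\<in>UNIV. a j) (\<Sum>k\<in>UNIV. b k) = (\<Sum>j\<in>UNIV. \<Sum>k\<in>UNIV. H (a j) (b k))"
    for a b :: "'n \<Rightarrow> complex ^ 'n"
    by (simp add: linear_sum[OF linl] linear_sum[OF linr]) (rule sum.swap)
  have summand: "wirtinger j (wirtinger_bar k (\<lambda>w. complex_of_real (\<rho> w))) z * (l $ j) * cnj (l $ k) =
      (complex_of_real (H (x j) (x k) + H (y j) (y k)) + \<i> * (H (x j) (y k) - H (y j) (x k))) / 4"
    (is "_ = ?R / 4") for j k
  proof -
    note lin = linear_add[OF linl] linear_add[OF linr] linear_diff[OF linl] linear_diff[OF linr]
      linear_scale[OF linl] linear_scale[OF linr] real_scaleR_def
    define A B C' D' where "A = H (e j) (e k)" and "B = H (e j) (f k)"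
      and "C' = H (f j) (e k)" and "D' = H (f j) (f k)"
    define lj lk where "lj = l $ j" and "lk = l $ k"
    have "?R = (complex_of_real (A + D') + \<i> * (B - C')) * lj * cnj lk"
      unfolding x_def y_def lin A_def[symmetric] B_def[symmetric] C'_def[symmetric] D'_def[symmetric]
        lj_def[symmetric] lk_def[symmetric] complex_eq_iff
      by (simp, algebra)
    then show ?thesis
      unfolding C A_def B_def C'_def D'_def lj_def lk_def by simp
  qed
  have "levi_form \<rho> z l = (complex_of_real (H l l + H (\<i> *s l) (\<i> *s l))
      + \<i> * (H l (\<i> *s l) - H (\<i> *s l) l)) / 4"
    unfolding levi_form_def summand unfolding il unfolding l HS
    by (simp only: of_real_add of_real_diff of_real_sum ring_distribs sum_distrib_left
        sum_divide_distrib add_divide_distrib diff_divide_distrib sum.distrib sum_subtractf)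
  then show ?thesis using sym[of l "\<i> *s l"] by simp
qed

section \<open>Estimates\<close>

text \<open>Write \<open>w = f\<nu> + g\<kappa>\<close>. In the plane of \<open>\<nu>\<close> and \<open>\<kappa>\<close>, the vector
  \<open>\<eta> = (\<kappa> \<bullet> w)\<nu> - (\<nu> \<bullet> w)\<kappa>\<close> is \<open>w\<close> turned by a right angle and scaled by the area spanned by \<open>\<nu>\<close> and \<open>\<kappa>\<close>.
  Its inner product with \<open>l\<close> is \<open>n|w|\<^sup>2\<close>, so the claim is the Cauchy-Schwarz inequality for \<open>\<eta>\<close> and \<open>l\<close>.\<close>

lemma gram_bound:
  fixes \<nu> \<kappa> l :: "'a::real_inner"
  assumes "\<nu> \<bullet> l = g * n" "\<kappa> \<bullet> l = - (f * n)"
  shows "n\<^sup>2 * (norm (f *\<^sub>R \<nu> + g *\<^sub>R \<kappa>))\<^sup>2 \<le> (norm \<nu>)\<^sup>2 * (norm \<kappa>)\<^sup>2 * (norm l)\<^sup>2"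
proof -
  define w where "w = f *\<^sub>R \<nu> + g *\<^sub>R \<kappa>"
  define \<eta> where "\<eta> = (\<kappa> \<bullet> w) *\<^sub>R \<nu> - (\<nu> \<bullet> w) *\<^sub>R \<kappa>"
  have \<nu>w: "\<nu> \<bullet> w = f * (\<nu> \<bullet> \<nu>) + g * (\<nu> \<bullet> \<kappa>)"
    and \<kappa>w: "\<kappa> \<bullet> w = f * (\<nu> \<bullet> \<kappa>) + g * (\<kappa> \<bullet> \<kappa>)"
    and ww: "w \<bullet> w = f * (\<nu> \<bullet> w) + g * (\<kappa> \<bullet> w)"
    by (simp_all add: w_def inner_right_distrib inner_left_distrib inner_commute[of \<kappa> \<nu>])
  have "\<eta> \<bullet> l = n * (w \<bullet> w)"
    unfolding \<eta>_def ww by (simp add: inner_diff_left assms algebra_simps)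
  then have cs: "(n * (norm w)\<^sup>2)\<^sup>2 \<le> (norm \<eta>)\<^sup>2 * (norm l)\<^sup>2"
    using Cauchy_Schwarz_ineq[of \<eta> l] by (simp add: power2_norm_eq_inner)
  have \<eta>: "(norm \<eta>)\<^sup>2 = (norm w)\<^sup>2 * ((norm \<nu>)\<^sup>2 * (norm \<kappa>)\<^sup>2 - (\<nu> \<bullet> \<kappa>)\<^sup>2)"
  proof -
    have "\<eta> \<bullet> \<eta> = (\<kappa> \<bullet> w)\<^sup>2 * (\<nu> \<bullet> \<nu>) - 2 * (\<kappa> \<bullet> w) * (\<nu> \<bullet> w) * (\<nu> \<bullet> \<kappa>)
        + (\<nu> \<bullet> w)\<^sup>2 * (\<kappa> \<bullet> \<kappa>)"
      unfolding \<eta>_def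
      by (simp add: inner_diff_left inner_diff_right inner_commute[of \<kappa> \<nu>] power2_eq_square algebra_simps)
    then show ?thesis
      unfolding power2_norm_eq_inner ww \<nu>w \<kappa>w by algebra
  qed
  define W m where "W = (norm w)\<^sup>2" and "m = (norm \<nu>)\<^sup>2 * (norm \<kappa>)\<^sup>2"
  have "(n * W)\<^sup>2 \<le> W * (m - (\<nu> \<bullet> \<kappa>)\<^sup>2) * (norm l)\<^sup>2"
    using cs unfolding \<eta> W_def m_def .
  also have "\<dots> \<le> W * m * (norm l)\<^sup>2"
    by (intro mult_right_mono mult_left_mono) (auto simp: W_def)
  finally have "(n * W)\<^sup>2 \<le> W * m * (norm l)\<^sup>2" .
  moreover have "(n * W)\<^sup>2 = W * (n\<^sup>2 * W)" by (simp add: power2_eq_square)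
  ultimately have "W * (n\<^sup>2 * W) \<le> W * (m * (norm l)\<^sup>2)"
    by (simp only: mult.assoc)
  then have "n\<^sup>2 * W \<le> m * (norm l)\<^sup>2 \<or> W = 0"
    by (subst (asm) mult_le_cancel_left) (auto simp: W_def)
  then have "n\<^sup>2 * W \<le> m * (norm l)\<^sup>2"
    by (auto simp: m_def)
  then show ?thesis by (simp only: W_def m_def w_def)
qed

text \<open>Multiplying \<open>\<nu>\<close> and \<open>\<kappa>\<close> by the complex number \<open>c - \<i>d\<close> rotates all the mass into the direction of
  \<open>l\<close>: the inner products with \<open>l\<close> become \<open>g(c\<^sup>2 + d\<^sup>2)\<close> and \<open>-f(c\<^sup>2 + d\<^sup>2)\<close>, so that the real bound applies
  and controls both coefficients simultaneously. Applying it to \<open>c\<close> and \<open>d\<close> separately would lose a factor of two.\<close>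

lemma complex_gram_bound:
  fixes \<nu> \<kappa> l :: "complex ^ 'n"
  assumes "\<nu> \<bullet> l = g * c" "\<kappa> \<bullet> l = - (f * c)"
    and "\<nu> \<bullet> (\<i> *s l) = g * d" "\<kappa> \<bullet> (\<i> *s l) = - (f * d)"
  shows "(c\<^sup>2 + d\<^sup>2) * (norm (f *\<^sub>R \<nu> + g *\<^sub>R \<kappa>))\<^sup>2 \<le> (norm \<nu>)\<^sup>2 * (norm \<kappa>)\<^sup>2 * (norm l)\<^sup>2"
proof -
  define n where "n = c\<^sup>2 + d\<^sup>2"
  \<comment> \<open>multiplication by \<open>c - \<i>d\<close>\<close>
  define T where "T u = c *\<^sub>R u - d *\<^sub>R (\<i> *s u)" for u :: "complex ^ 'n"
  have T_norm: "(norm (T u))\<^sup>2 = n * (norm u)\<^sup>2" for u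
  proof -
    have "orthogonal (c *\<^sub>R u) (d *\<^sub>R (\<i> *s u))" by (simp add: orthogonal_def inner_imaginary_unit(5))
    then have "orthogonal (c *\<^sub>R u) (- (d *\<^sub>R (\<i> *s u)))" by (simp add: orthogonal_def)
    from norm_add_Pythagorean[OF this] show ?thesis
      by (simp add: T_def n_def inner_imaginary_unit(4) power_mult_distrib distrib_right)
  qed
  have T_inner: "T u \<bullet> l = c * (u \<bullet> l) + d * (u \<bullet> (\<i> *s l))" for u
    unfolding T_def by (simp add: inner_diff_left inner_imaginary_unit(2))
  have "f *\<^sub>R T \<nu> + g *\<^sub>R T \<kappa> = T (f *\<^sub>R \<nu> + g *\<^sub>R \<kappa>)"
    by (simp add: T_def vec_eq_iff complex_eq_iff algebra_simps)
  moreover have "n\<^sup>2 * (norm (f *\<^sub>R T \<nu> + g *\<^sub>R T \<kappa>))\<^sup>2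
      \<le> (norm (T \<nu>))\<^sup>2 * (norm (T \<kappa>))\<^sup>2 * (norm l)\<^sup>2"
    by (rule gram_bound) (simp_all add: T_inner assms n_def algebra_simps power2_eq_square)
  ultimately have "n\<^sup>2 * (n * (norm (f *\<^sub>R \<nu> + g *\<^sub>R \<kappa>))\<^sup>2) \<le> n\<^sup>2 * ((norm \<nu>)\<^sup>2 * (norm \<kappa>)\<^sup>2 * (norm l)\<^sup>2)"
    by (simp add: T_norm) (simp add: power2_eq_square mult_ac)
  moreover have "0 \<le> n" by (simp add: n_def)
  ultimately have "n * (norm (f *\<^sub>R \<nu> + g *\<^sub>R \<kappa>))\<^sup>2 \<le> (norm \<nu>)\<^sup>2 * (norm \<kappa>)\<^sup>2 * (norm l)\<^sup>2 \<or> n = 0"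
    by (subst (asm) mult_le_cancel_left) auto
  then show ?thesis unfolding n_def by auto
qed

text \<open>The scalar inequality behind the positivity of the Levi form; with \<open>f = 2pq + q\<^sup>2\<close> and
  \<open>g = p\<^sup>2 + 2pq\<close>, the two factors on the right are \<open>f + g\<close> and \<open>(f\<^sup>2p + g\<^sup>2q) / (pq)\<close>.\<close>

lemma quintic_inequality:
  fixes p q :: real
  assumes "0 \<le> p" "0 \<le> q"
  shows "12 * (p * q * (p + q) * (p\<^sup>2 + p * q + q\<^sup>2))
    \<le> 6 / 7 * ((p\<^sup>2 + 4 * p * q + q\<^sup>2) * (q * (2 * p + q)\<^sup>2 + p * (p + 2 * q)\<^sup>2))"
proof -
  have "6 * ((p\<^sup>2 + 4 * p * q + q\<^sup>2) * (q * (2 * p + q)\<^sup>2 + p * (p + 2 * q)\<^sup>2))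
      - 84 * (p * q * (p + q) * (p\<^sup>2 + p * q + q\<^sup>2))
    = 6 * p ^ 3 * (p - q)\<^sup>2 + 6 * q ^ 3 * (p - q)\<^sup>2 + 72 * p ^ 3 * q\<^sup>2 + 72 * p\<^sup>2 * q ^ 3"
    by (simp add: algebra_simps power2_eq_square power3_eq_cube)
  also have "\<dots> \<ge> 0" using assms by (intro add_nonneg_nonneg mult_nonneg_nonneg) auto
  finally show ?thesis by simp
qed

text \<open>Split \<open>l = x + y\<close> with \<open>y = Kl\<close>. The projector \<open>Q\<close> nearly fixes \<open>x\<close> and nearly kills \<open>y\<close>, so \<open>|Ql|\<^sup>2\<close> is
  nearly \<open>|x|\<^sup>2\<close>. The parts \<open>x\<close> of \<open>l\<close> and of \<open>\<i>l\<close> together have squared norm \<open>|l|\<^sup>2\<close>.\<close>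

lemma projector_half_bound:
  fixes Q K :: "complex ^ 'n \<Rightarrow> complex ^ 'n"
  assumes Q: "orthogonal_projector Q" and K: "orthogonal_projector K"
    and half: "\<And>l. (norm (K l))\<^sup>2 + (norm (K (\<i> *s l)))\<^sup>2 = (norm l)\<^sup>2"
    and QK: "\<And>x. norm (Q (K x)) \<le> a * norm (K x)"
    and Q_id: "\<And>x. norm ((x - K x) - Q (x - K x)) \<le> a * norm (x - K x)"
    and a: "0 \<le> a"
  shows "(1 - 2 * a - a\<^sup>2) * (norm l)\<^sup>2 \<le> (norm (Q l))\<^sup>2 + (norm (Q (\<i> *s l)))\<^sup>2"
proof -
  interpret Q: bounded_linear Q using Q by (simp add: orthogonal_projector_def)
  have pyth: "(norm (x - P x))\<^sup>2 = (norm x)\<^sup>2 - (norm (P x))\<^sup>2"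
    if "orthogonal_projector P" for P and x :: "complex ^ 'n"
    unfolding power2_norm_eq_inner
    using projector_inner[OF that, of x x] by (simp add: inner_diff_left inner_diff_right)
  have one: "(1 - a\<^sup>2) * (norm (l - K l))\<^sup>2 - a * (norm l)\<^sup>2 \<le> (norm (Q l))\<^sup>2" for l
  proof -
    define x y where "x = l - K l" and "y = K l"
    have "(norm (x - Q x))\<^sup>2 \<le> (a * norm x)\<^sup>2"
      using Q_id[of l] unfolding x_def by (intro power_mono) auto
    then have 1: "(1 - a\<^sup>2) * (norm x)\<^sup>2 \<le> (norm (Q x))\<^sup>2"
      unfolding pyth[OF Q] by (simp add: power_mult_distrib algebra_simps)
    have "- (Q x \<bullet> Q y) \<le> norm x * (a * norm y)"
    proof -
      have "- (Q x \<bullet> Q y) = - (x \<bullet> Q y)" using projector_inner[OF Q] by metis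
      also have "\<dots> \<le> norm x * norm (Q y)" using norm_cauchy_schwarz[of "- x" "Q y"] by simp
      also have "\<dots> \<le> norm x * (a * norm y)"
        using QK[of l] unfolding y_def by (intro mult_left_mono) auto
      finally show ?thesis .
    qed
    moreover have "2 * (norm x * (a * norm y)) \<le> a * ((norm x)\<^sup>2 + (norm y)\<^sup>2)"
      using mult_left_mono[OF sum_squares_bound[of "norm x" "norm y"] a] by (simp add: mult_ac)
    moreover have "a * ((norm x)\<^sup>2 + (norm y)\<^sup>2) = a * (norm l)\<^sup>2"
      unfolding x_def y_def pyth[OF K] by simp
    moreover have "(norm (Q l))\<^sup>2 = (norm (Q x))\<^sup>2 + 2 * (Q x \<bullet> Q y) + (norm (Q y))\<^sup>2"
    proof -
      have "Q l = Q x + Q y" unfolding x_def y_def by (simp add: Q.add[symmetric])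
      then show ?thesis
        by (simp add: power2_norm_eq_inner inner_left_distrib inner_right_distrib inner_commute)
    qed
    ultimately show ?thesis using 1 zero_le_power2[of "norm (Q y)"] unfolding x_def y_def by linarith
  qed
  have "(norm (l - K l))\<^sup>2 + (norm (\<i> *s l - K (\<i> *s l)))\<^sup>2 = (norm l)\<^sup>2"
    unfolding pyth[OF K] using half[of l] by (simp add: inner_imaginary_unit)
  then have "(1 - a\<^sup>2) * (norm (l - K l))\<^sup>2 + (1 - a\<^sup>2) * (norm (\<i> *s l - K (\<i> *s l)))\<^sup>2
      = (1 - a\<^sup>2) * (norm l)\<^sup>2"
    by (metis distrib_left)
  then show ?thesis
    using one[of l] one[of "\<i> *s l"] by (simp add: inner_imaginary_unit algebra_simps)
qed

text \<open>Here \<open>W\<close> stands for \<open>|w|\<^sup>2\<close>, \<open>L\<close> for \<open>|l|\<^sup>2\<close> and \<open>S\<close> for \<open>|Ql|\<^sup>2 + |Q\<i>l|\<^sup>2\<close>. After multiplication by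
  \<open>W > 0\<close> the bound on \<open>n W\<close> can be inserted, and the slack \<open>6/7\<close> in the quintic inequality absorbs
  the two perturbation factors, because \<open>(1 - 2a - a\<^sup>2)(1 - a) \<ge> 574/625 \<sqdot> 24/25 > 6/7\<close> for \<open>a \<le> 1/25\<close>.\<close>

lemma levi_scalar_positive:
  fixes p q a L n W S :: real
  assumes "0 < p" "0 < q" "0 \<le> a" "a \<le> 1 / 25" "0 < L"
    and W: "(1 - a) * ((2*p*q + q\<^sup>2)\<^sup>2 * p + (p\<^sup>2 + 2*p*q)\<^sup>2 * q) \<le> W"
    and n: "n * W \<le> p * q * L"
    and S: "(1 - 2 * a - a\<^sup>2) * L \<le> S"
  shows "12 * (p * q * (p + q) * (p\<^sup>2 + p * q + q\<^sup>2)) * n < (2*p*q + q\<^sup>2) * S + (p\<^sup>2 + 2*p*q) * L"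
proof -
  define X where "X = q * (2 * p + q)\<^sup>2 + p * (p + 2 * q)\<^sup>2"
  define R where "R = p * q * (p + q) * (p\<^sup>2 + p * q + q\<^sup>2)"
  define E where "E = p\<^sup>2 + 4 * p * q + q\<^sup>2"
  define t where "t = 1 - 2 * a - a\<^sup>2"
  have pos: "0 < X" "0 < R" "0 < E"
    unfolding X_def R_def E_def using assms by (auto intro!: add_pos_pos mult_pos_pos)
  have "a\<^sup>2 \<le> (1/25)\<^sup>2" using assms by (intro power_mono) auto
  then have t: "574/625 \<le> t" unfolding t_def power_divide using assms(4) by simp
  have t1: "t \<le> 1" unfolding t_def using assms(3) zero_le_power2[of a] by linarith
  have fX: "(2*p*q + q\<^sup>2)\<^sup>2 * p + (p\<^sup>2 + 2*p*q)\<^sup>2 * q = p * q * X"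
    unfolding X_def by (simp add: algebra_simps power2_eq_square)
  have Wpos: "0 < W"
  proof -
    have "0 < (1 - a) * (p * q * X)" using assms pos by auto
    then show ?thesis using W fX by simp
  qed
  have "12 * R * n * W = 12 * R * (n * W)" by simp
  also have "\<dots> \<le> 12 * R * (p * q * L)"
    using n pos by (intro mult_left_mono) auto
  also have "\<dots> \<le> 6 / 7 * (E * X) * (p * q * L)"
    using quintic_inequality[of p q] assms unfolding R_def E_def X_def
    by (intro mult_right_mono) auto
  also have "\<dots> < (574/625 * (24/25)) * (E * X) * (p * q * L)"
    using assms pos by (intro mult_strict_right_mono mult_pos_pos) auto
  also have "\<dots> \<le> (t * (1 - a)) * (E * X) * (p * q * L)"
    using assms pos t by (intro mult_right_mono mult_mono) auto
  also have "\<dots> = (t * E * L) * ((1 - a) * (p * q * X))" by simp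
  also have "\<dots> \<le> (t * E * L) * W"
    using W t pos assms unfolding fX by (intro mult_left_mono) auto
  finally have "12 * R * n < t * E * L"
    using Wpos by (simp add: mult_less_cancel_right)
  also have "t * E * L = (2*p*q + q\<^sup>2) * (t * L) + (p\<^sup>2 + 2*p*q) * (t * L)"
    unfolding E_def by (simp add: algebra_simps)
  also have "\<dots> \<le> (2*p*q + q\<^sup>2) * S + (p\<^sup>2 + 2*p*q) * L"
    using S t t1 assms unfolding t_def[symmetric]
    by (intro add_mono mult_left_mono) (auto simp: mult_left_le_one_le)
  finally show ?thesis unfolding R_def by simp
qed

section \<open>Two almost orthogonal planes\<close>

text \<open>The assumption \<open>half\<close> says that multiplication by \<open>\<i>\<close> exchanges the range of \<open>K\<close> and its orthogonal
  complement, as is the case for the imaginary and the real vectors. The next two say that \<open>Q\<close> is close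
  to the complementary projector \<open>id - K\<close>.\<close>

locale almost_orthogonal_planes =
  fixes Q K :: "complex ^ 'n \<Rightarrow> complex ^ 'n" and a :: real
  assumes Q: "orthogonal_projector Q" and K: "orthogonal_projector K"
    and half: "\<And>l. (norm (K l))\<^sup>2 + (norm (K (\<i> *s l)))\<^sup>2 = (norm l)\<^sup>2"
    and QK: "\<And>x. norm (Q (K x)) \<le> a * norm (K x)"
    and Q_id: "\<And>x. norm ((x - K x) - Q (x - K x)) \<le> a * norm (x - K x)"
    and a: "0 \<le> a" "a \<le> 1 / 25"
begin

definition p where "p z = (norm (Q z))\<^sup>2"
definition q where "q z = (norm (K z))\<^sup>2"
definition r where "r z = (p z)\<^sup>2 * q z + p z * (q z)\<^sup>2"

sublocale Q: bounded_linear Q using Q by (simp add: orthogonal_projector_def)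
sublocale K: bounded_linear K using K by (simp add: orthogonal_projector_def)

lemma p_derivative: "(p has_derivative (\<lambda>h. 2 * (Q z \<bullet> h))) (at z)"
  unfolding p_def[abs_def] by (rule projector_has_derivative_norm2[OF Q])

lemma q_derivative: "(q has_derivative (\<lambda>h. 2 * (K z \<bullet> h))) (at z)"
  unfolding q_def[abs_def] by (rule projector_has_derivative_norm2[OF K])

definition dr where
  "dr z h = 2 * ((2 * p z * q z + (q z)\<^sup>2) * (Q z \<bullet> h) + ((p z)\<^sup>2 + 2 * p z * q z) * (K z \<bullet> h))"

text \<open>The Hessian of \<open>r\<close> by the chain rule. The derivatives of \<open>2pq + q\<^sup>2\<close> and \<open>p\<^sup>2 + 2pq\<close> are combinations of the
  derivatives \<open>2 Qz \<bullet> u\<close> and \<open>2 Kz \<bullet> u\<close> of \<open>p\<close> and \<open>q\<close>.\<close>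

definition ddr where
  "ddr z u v = 2 * ((4 * q z * (Q z \<bullet> u) + 4 * (p z + q z) * (K z \<bullet> u)) * (Q z \<bullet> v)
     + (2 * p z * q z + (q z)\<^sup>2) * (Q u \<bullet> v)
     + (4 * (p z + q z) * (Q z \<bullet> u) + 4 * p z * (K z \<bullet> u)) * (K z \<bullet> v)
     + ((p z)\<^sup>2 + 2 * p z * q z) * (K u \<bullet> v))"

lemma r_derivative: "(r has_derivative dr z) (at z)"
  unfolding r_def[abs_def] dr_def[abs_def]
  by (rule has_derivative_eq_rhs, (rule derivative_intros p_derivative q_derivative)+)
    (simp add: fun_eq_iff algebra_simps power2_eq_square)

lemma dr_derivative: "((\<lambda>w. dr w v) has_derivative (\<lambda>u. ddr z u v)) (at z)"
proof -
  have 1: "((\<lambda>w. Q w \<bullet> v) has_derivative (\<lambda>u. Q u \<bullet> v)) (at z)"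
    "((\<lambda>w. K w \<bullet> v) has_derivative (\<lambda>u. K u \<bullet> v)) (at z)"
    by (auto intro!: bounded_linear_imp_has_derivative Q.bounded_linear_axioms K.bounded_linear_axioms
        bounded_linear_inner_left_comp)
  show ?thesis
    unfolding dr_def ddr_def
    by (rule has_derivative_eq_rhs, (rule derivative_intros p_derivative q_derivative 1)+)
      (simp add: fun_eq_iff algebra_simps power2_eq_square)
qed

lemma ddr_sym: "ddr z u v = ddr z v u"
proof -
  have "Q u \<bullet> v = Q v \<bullet> u" "K u \<bullet> v = K v \<bullet> u"
    using projector_inner(2)[OF Q, of u v] projector_inner(2)[OF K, of u v]
    by (simp_all add: inner_commute)
  then show ?thesis unfolding ddr_def by (simp add: algebra_simps)
qed

lemma C2_r: "C2_function r"
proof -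
  have "C2_function p" "C2_function q"
    unfolding p_def[abs_def] q_def[abs_def] using C2_projector_norm2 Q K by auto
  then show ?thesis
    unfolding r_def[abs_def] power2_eq_square by (intro C2_add C2_mult)
qed

lemma r_scaleR: "r (t *\<^sub>R z) = t ^ 6 * r z"
  unfolding r_def p_def q_def Q.scaleR K.scaleR norm_scaleR
  by (simp add: power_mult_distrib algebra_simps)

lemma r_nonneg: "0 \<le> r z"
  unfolding r_def p_def q_def by simp

lemma euler: "dr z z = 6 * r z"
proof -
  have "Q z \<bullet> z = p z" "K z \<bullet> z = q z"
    unfolding p_def q_def power2_norm_eq_inner using projector_inner[OF Q] projector_inner[OF K] by auto
  then show ?thesis unfolding dr_def r_def by (simp add: algebra_simps power2_eq_square)
qed

lemma r_pos: assumes "0 < r z" shows "0 < p z" "0 < q z"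
proof -
  have "p z \<noteq> 0" "q z \<noteq> 0" using assms by (auto simp: r_def)
  then show "0 < p z" "0 < q z" by (simp_all add: p_def q_def)
qed

text \<open>Only the real inner product of \<open>Qz\<close> and \<open>Kz\<close> enters, and it is small since it equals
  \<open>Qz \<bullet> Q(Kz)\<close>, where \<open>Q\<close> nearly kills the range of \<open>K\<close>.\<close>

lemma gradient_norm_bound:
  assumes "0 \<le> f" "0 \<le> g"
  shows "(1 - a) * (f\<^sup>2 * p z + g\<^sup>2 * q z) \<le> (norm (f *\<^sub>R Q z + g *\<^sub>R K z))\<^sup>2"
proof -
  have "- (Q z \<bullet> K z) = - (Q z \<bullet> Q (K z))" using projector_inner[OF Q] by metis
  also have "\<dots> \<le> norm (Q z) * norm (Q (K z))"
    using norm_cauchy_schwarz[of "- Q z" "Q (K z)"] by simp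
  also have "\<dots> \<le> norm (Q z) * (a * norm (K z))" using QK by (intro mult_left_mono) auto
  finally have "(2 * f * g) * - (Q z \<bullet> K z) \<le> (2 * f * g) * (norm (Q z) * (a * norm (K z)))"
    using assms by (intro mult_left_mono) auto
  also have "\<dots> = a * (2 * (f * norm (Q z)) * (g * norm (K z)))" by simp
  also have "\<dots> \<le> a * ((f * norm (Q z))\<^sup>2 + (g * norm (K z))\<^sup>2)"
    using a by (intro mult_left_mono sum_squares_bound) auto
  finally have "- a * (f\<^sup>2 * p z + g\<^sup>2 * q z) \<le> 2 * f * g * (Q z \<bullet> K z)"
    by (simp add: p_def q_def power_mult_distrib)
  moreover have "(norm (f *\<^sub>R Q z + g *\<^sub>R K z))\<^sup>2
      = f\<^sup>2 * p z + g\<^sup>2 * q z + 2 * f * g * (Q z \<bullet> K z)"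
    unfolding p_def q_def power2_norm_eq_inner
    by (simp add: inner_left_distrib inner_right_distrib inner_commute[of "K z" "Q z"]
        algebra_simps power2_eq_square)
  ultimately show ?thesis by (simp add: algebra_simps)
qed

text \<open>Tangency forces the two differentials into the ratio \<open>g : -f\<close>. On such a direction the second derivatives of
  \<open>p\<^sup>2q + pq\<^sup>2\<close> with respect to \<open>p\<close> and \<open>q\<close> contribute \<open>8c\<^sup>2(qg\<^sup>2 - 2(p + q)fg + pf\<^sup>2)\<close>, a negative
  multiple of \<open>c\<^sup>2\<close>.\<close>

lemma ddr_tangential:
  assumes "Q z \<bullet> h = ((p z)\<^sup>2 + 2 * p z * q z) * c" "K z \<bullet> h = - ((2 * p z * q z + (q z)\<^sup>2) * c)"
  shows "ddr z h h = 2 * (2 * p z * q z + (q z)\<^sup>2) * (norm (Q h))\<^sup>2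
     + 2 * ((p z)\<^sup>2 + 2 * p z * q z) * (norm (K h))\<^sup>2
     - 24 * (p z * q z * (p z + q z) * ((p z)\<^sup>2 + p z * q z + (q z)\<^sup>2)) * c\<^sup>2"
proof -
  have "Q h \<bullet> h = (norm (Q h))\<^sup>2" "K h \<bullet> h = (norm (K h))\<^sup>2"
    unfolding power2_norm_eq_inner using projector_inner[OF Q] projector_inner[OF K] by auto
  then show ?thesis unfolding ddr_def assms by algebra
qed

lemma levi_form_r: "levi_form r z l = complex_of_real ((ddr z l l + ddr z (\<i> *s l) (\<i> *s l)) / 4)"
  by (rule levi_form_eq_hessian[OF r_derivative dr_derivative ddr_sym])

lemma levi_form_r_pos:
  assumes z: "0 < r z" and l: "l \<noteq> 0" "dr z l = 0" "dr z (\<i> *s l) = 0"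
  shows "0 < ddr z l l + ddr z (\<i> *s l) (\<i> *s l)"
proof -
  define f g where "f = 2 * p z * q z + (q z)\<^sup>2" and "g = (p z)\<^sup>2 + 2 * p z * q z"
  have pq: "0 < p z" "0 < q z" using r_pos[OF z] by auto
  have fg: "0 < f" "0 < g" using pq by (simp_all add: f_def g_def add_pos_pos)
  define R where "R = p z * q z * (p z + q z) * ((p z)\<^sup>2 + p z * q z + (q z)\<^sup>2)"
  \<comment> \<open>tangency makes \<open>(Qz \<bullet> h, Kz \<bullet> h)\<close> proportional to \<open>(g, - f)\<close>\<close>
  define c where "c h = (Q z \<bullet> h) / g" for h
  have c1: "Q z \<bullet> h = g * c h" for h using fg by (simp add: c_def)
  have c2: "K z \<bullet> h = - (f * c h)" if "dr z h = 0" for h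
    using that fg unfolding dr_def f_def[symmetric] g_def[symmetric] c_def by (simp add: field_simps)
  have H: "ddr z h h = 2 * f * (norm (Q h))\<^sup>2 + 2 * g * (norm (K h))\<^sup>2 - 24 * R * (c h)\<^sup>2"
    if "dr z h = 0" for h
    unfolding f_def g_def R_def
    by (rule ddr_tangential) (use c1[of h] c2[OF that] in \<open>simp_all add: f_def g_def\<close>)
  define n where "n = (c l)\<^sup>2 + (c (\<i> *s l))\<^sup>2"
  define S where "S = (norm (Q l))\<^sup>2 + (norm (Q (\<i> *s l)))\<^sup>2"
  have "12 * R * n < f * S + g * (norm l)\<^sup>2"
    unfolding R_def f_def g_def
  proof (rule levi_scalar_positive)
    show "n * (norm (f *\<^sub>R Q z + g *\<^sub>R K z))\<^sup>2 \<le> p z * q z * (norm l)\<^sup>2"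
      unfolding n_def p_def q_def using c1 c2 l by (intro complex_gram_bound) auto
    show "(1 - 2 * a - a\<^sup>2) * (norm l)\<^sup>2 \<le> S"
      unfolding S_def by (rule projector_half_bound[OF Q K half QK Q_id a(1)])
    show "(1 - a) * ((2 * p z * q z + (q z)\<^sup>2)\<^sup>2 * p z + ((p z)\<^sup>2 + 2 * p z * q z)\<^sup>2 * q z)
      \<le> (norm (f *\<^sub>R Q z + g *\<^sub>R K z))\<^sup>2"
      unfolding f_def[symmetric] g_def[symmetric] using fg by (intro gradient_norm_bound) auto
  qed (use pq a l in auto)
  moreover have "ddr z l l + ddr z (\<i> *s l) (\<i> *s l) = 2 * (f * S + g * (norm l)\<^sup>2 - 12 * R * n)"
    unfolding H[OF l(2)] H[OF l(3)] S_def n_def half[of l, symmetric] by (simp add: algebra_simps)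
  ultimately show ?thesis by simp
qed

text \<open>Homogeneity gives star-shapedness and shows that points \<open>tz\<close> with \<open>t < 1\<close> approach a point \<open>z\<close> of the level set from
  inside; the derivative at \<open>z\<close> in the direction \<open>z\<close> is \<open>6\<epsilon>\<close>.\<close>

lemma r_sublevel_pseudoconvex:
  assumes \<epsilon>: "0 < \<epsilon>"
  shows "strongly_Levi_pseudoconvex_sublevel r \<epsilon>"
proof -
  let ?S = "{z. r z < \<epsilon>}"
  have cont: "continuous_on UNIV r" using C1_continuous C2_imp_C1 C2_r by blast
  have op: "open ?S" using cont by (intro open_Collect_less) auto
  have r0: "r 0 = 0" using r_scaleR[of 0 0] by simp
  have "starlike ?S"
    unfolding starlike_def
  proof (intro bexI ballI subsetI)
    fix x y assume x: "x \<in> ?S" and "y \<in> closed_segment 0 x"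
    then obtain t where t: "0 \<le> t" "t \<le> 1" "y = t *\<^sub>R x" by (auto simp: closed_segment_def)
    have "t ^ 6 * r x \<le> r x" using t r_nonneg[of x] by (intro mult_left_le_one_le) (auto intro: power_le_one)
    then show "y \<in> ?S" using x t by (simp add: r_scaleR)
  qed (use r0 \<epsilon> in simp)
  then have conn: "connected ?S" by (rule starlike_imp_connected)
  have fr: "frontier ?S = {z. r z = \<epsilon>}"
  proof
    have "closure ?S \<subseteq> {z. r z \<le> \<epsilon>}"
      using cont by (intro closure_minimal closed_Collect_le) auto
    then show "frontier ?S \<subseteq> {z. r z = \<epsilon>}"
      using op by (auto simp: frontier_def interior_open)
    show "{z. r z = \<epsilon>} \<subseteq> frontier ?S"
    proof
      fix z assume z: "z \<in> {z. r z = \<epsilon>}"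
      define t where "t n = real n / real (Suc n)" for n
      have "(\<lambda>n. t n *\<^sub>R z) \<longlonglongrightarrow> 1 *\<^sub>R z"
        unfolding t_def by (intro tendsto_scaleR LIMSEQ_n_over_Suc_n tendsto_const)
      moreover have "t n *\<^sub>R z \<in> ?S" for n
      proof -
        have "0 \<le> t n" "t n < 1" by (simp_all add: t_def)
        then have "t n ^ 6 < 1" by (simp add: power_less_one_iff)
        then show ?thesis using z \<epsilon> by (simp add: r_scaleR)
      qed
      ultimately have "z \<in> closure ?S" unfolding closure_sequential by (intro exI[of _ "\<lambda>n. t n *\<^sub>R z"]) simp
      then show "z \<in> frontier ?S" using z op by (auto simp: frontier_def interior_open)
    qed
  qed
  have fd: "frechet_derivative r (at z) = dr z" for z
    using frechet_derivative_at[OF r_derivative] by simp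
  have grad: "dr z \<noteq> (\<lambda>h. 0)" if "r z = \<epsilon>" for z
    using euler[of z] that \<epsilon> by auto
  have levi: "levi_form r z l \<in> \<real> \<and> Re (levi_form r z l) > 0"
    if z: "r z = \<epsilon>" and l: "l \<in> complex_tangent_space r z" "l \<noteq> 0" for z l
  proof -
    obtain v where v: "dr z l = 0" "dr z v = 0" "l = \<i> *s v"
      using l(1) by (auto simp: complex_tangent_space_def tangent_space_def fd)
    have "dr z (\<i> *s l) = 0"
      using v linear_neg[OF has_derivative_linear[OF r_derivative]] by (simp add: inner_imaginary_unit(3))
    then have "0 < ddr z l l + ddr z (\<i> *s l) (\<i> *s l)"
      using levi_form_r_pos[of z l] z \<epsilon> l(2) v(1) by simp
    then show ?thesis unfolding levi_form_r by simp
  qed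
  show ?thesis
    unfolding strongly_Levi_pseudoconvex_sublevel_def fr fd
    using C2_r op conn grad levi r0 \<epsilon> by (auto intro!: exI[of _ 0])
qed

end

section \<open>Real plane and graph of a small matrix\<close>

lemma cvec_simps:
  fixes u v :: "real ^ 'n"
  shows "cvec u \<bullet> cvec v = u \<bullet> v" "cvec u \<bullet> (\<i> *s cvec v) = 0" "norm (cvec u) = norm u"
    "cvec (u + v) = cvec u + cvec v" "cvec (c *\<^sub>R u) = c *\<^sub>R cvec u"
proof -
  show 1: "cvec u \<bullet> cvec v = u \<bullet> v" for u v :: "real ^ 'n"
    by (simp add: cvec_def inner_vec_def inner_complex_def)
  show "cvec u \<bullet> (\<i> *s cvec v) = 0" by (simp add: cvec_def inner_vec_def inner_complex_def)
  show "norm (cvec u) = norm u" by (simp add: norm_eq_sqrt_inner 1)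
  show "cvec (u + v) = cvec u + cvec v" "cvec (c *\<^sub>R u) = c *\<^sub>R cvec u"
    by (simp_all add: cvec_def vec_eq_iff complex_eq_iff)
qed

definition re_vec :: "complex ^ 'n \<Rightarrow> real ^ 'n" where "re_vec z = (\<chi> j. Re (z $ j))"
definition im_vec :: "complex ^ 'n \<Rightarrow> real ^ 'n" where "im_vec z = (\<chi> j. Im (z $ j))"
definition im_proj :: "complex ^ 'n \<Rightarrow> complex ^ 'n" where "im_proj z = \<i> *s cvec (im_vec z)"

lemma diff_im_proj: "z - im_proj z = cvec (re_vec z)"
  by (simp add: im_proj_def im_vec_def re_vec_def cvec_def vec_eq_iff complex_eq_iff)

lemma orthogonal_projector_im_proj: "orthogonal_projector im_proj"
  unfolding orthogonal_projector_def
proof (intro conjI allI)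
  show "bounded_linear (im_proj :: complex ^ 'n \<Rightarrow> complex ^ 'n)"
    unfolding linear_conv_bounded_linear[symmetric]
    by (rule linearI) (simp_all add: im_proj_def im_vec_def cvec_def vec_eq_iff complex_eq_iff)
  show "im_proj x \<bullet> y = x \<bullet> im_proj y" for x y :: "complex ^ 'n"
    by (simp add: im_proj_def im_vec_def cvec_def inner_vec_def inner_complex_def)
  show "im_proj (im_proj x) = im_proj x" for x :: "complex ^ 'n"
    by (simp add: im_proj_def im_vec_def cvec_def vec_eq_iff)
qed

lemma im_proj_half: "(norm (im_proj l))\<^sup>2 + (norm (im_proj (\<i> *s l)))\<^sup>2 = (norm l)\<^sup>2"
  by (simp add: im_proj_def im_vec_def cvec_def inner_vec_def inner_complex_def power2_norm_eq_inner
      sum.distrib[symmetric] add.commute)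

lemma sq_dist_real_plane: "sq_dist real_plane z = (norm (im_proj z))\<^sup>2"
proof (rule sq_dist_eq_projector)
  show "x - im_proj x \<in> real_plane" for x :: "complex ^ 'n"
    by (simp add: diff_im_proj real_plane_def)
  show "im_proj x \<bullet> y = 0" if "y \<in> real_plane" for x y :: "complex ^ 'n"
    using that by (auto simp: real_plane_def im_proj_def inner_imaginary_unit(2) cvec_simps)
qed

lemma totally_real_plane_graph:
  "totally_real_plane A = range (\<lambda>w. cvec (A *v w) + \<i> *s cvec w)"
proof -
  have "(\<chi> i j. complex_of_real (A $ i $ j) + \<i> * mat 1 $ i $ j) *v cvec w
      = cvec (A *v w) + \<i> *s cvec w" for w
    by (simp add: vec_eq_iff matrix_vector_mult_def cvec_def mat_def distrib_right sum.distrib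
        if_distrib[of "\<lambda>x. _ * x"] if_distrib[of "\<lambda>x. x * _"] cong: if_cong)
  then show ?thesis unfolding totally_real_plane_def by simp
qed

lemma subspace_totally_real_plane: "subspace (totally_real_plane A)"
proof -
  have "linear (\<lambda>w. cvec (A *v w) + \<i> *s cvec w)"
    by (rule linearI)
      (simp_all add: cvec_simps matrix_vector_right_distrib matrix_vector_mult_scaleR
        vec_eq_iff algebra_simps)
  then show ?thesis
    unfolding totally_real_plane_graph by (intro linear_subspace_image subspace_UNIV)
qed

text \<open>Points of \<open>M\<close> have the form \<open>Aw + \<i>w\<close>. For \<open>Q\<close> restricted to imaginary vectors \<open>\<i>w\<close>, replace \<open>\<i>w\<close> by
  \<open>-Aw\<close>, which differs from it by an element of \<open>M\<close>. For real \<open>u\<close>, the projection \<open>Aw + \<i>w\<close> of \<open>u\<close> to \<open>M\<close> pairs with \<open>u\<close> only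
  through its small real part \<open>Aw\<close>.\<close>

lemma rho_pseudoconvex:
  fixes A :: "real ^ 'n ^ 'n"
  assumes A: "\<And>w. norm (A *v w) \<le> a * norm w" and a: "0 \<le> a" "a \<le> 1 / 25" and \<epsilon>: "0 < \<epsilon>"
  shows "strongly_Levi_pseudoconvex_sublevel (rho A) \<epsilon>"
proof -
  let ?M = "totally_real_plane A"
  obtain Q where proj: "orthogonal_projector Q" "\<And>x. x - Q x \<in> ?M" "\<And>x y. y \<in> ?M \<Longrightarrow> Q x \<bullet> y = 0"
    using orthogonal_projector_onto_complement[OF subspace_totally_real_plane] by metis
  have graph: "cvec (A *v w) + \<i> *s cvec w \<in> ?M" for w
    by (simp add: totally_real_plane_graph)
  have "norm (Q (im_proj x)) \<le> a * norm (im_proj x)" for x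
  proof -
    define w where "w = im_vec x"
    have "(norm (Q (im_proj x)))\<^sup>2 = Q (im_proj x) \<bullet> (im_proj x)"
      unfolding power2_norm_eq_inner using projector_inner[OF proj(1)] by simp
    also have "\<dots> = Q (im_proj x) \<bullet> (- cvec (A *v w))"
      using proj(3)[OF graph[of w], of "im_proj x"]
      by (simp add: inner_right_distrib im_proj_def w_def)
    also have "\<dots> \<le> norm (Q (im_proj x)) * (a * norm w)"
      using A[of w] by (intro order_trans[OF norm_cauchy_schwarz] mult_left_mono) (auto simp: cvec_simps)
    finally have "norm (Q (im_proj x)) \<le> a * norm w \<or> norm (Q (im_proj x)) = 0"
      by (auto simp: power2_eq_square mult_le_cancel_left)
    moreover have "norm (im_proj x) = norm w"
      by (simp add: im_proj_def w_def inner_imaginary_unit cvec_simps)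
    ultimately show ?thesis using a by auto
  qed
  moreover have "norm (x - im_proj x - Q (x - im_proj x)) \<le> a * norm (x - im_proj x)" for x
  proof -
    define u where "u = re_vec x"
    have u: "x - im_proj x = cvec u" by (simp add: diff_im_proj u_def)
    obtain w where w: "cvec u - Q (cvec u) = cvec (A *v w) + \<i> *s cvec w"
      using proj(2)[of "cvec u"] unfolding totally_real_plane_graph by auto
    define m where "m = cvec u - Q (cvec u)"
    have "(norm m)\<^sup>2 = cvec u \<bullet> m"
      unfolding power2_norm_eq_inner m_def using projector_inner[OF proj(1), of "cvec u" "cvec u"]
      by (simp add: inner_diff_left inner_diff_right)
    also have "\<dots> = u \<bullet> (A *v w)"
      unfolding m_def w by (simp add: inner_right_distrib cvec_simps)
    also have "\<dots> \<le> norm u * (a * norm w)"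
      using A[of w] by (intro order_trans[OF norm_cauchy_schwarz] mult_left_mono) auto
    also have "\<dots> \<le> norm u * (a * norm m)"
    proof -
      have "(norm m)\<^sup>2 = (norm (A *v w))\<^sup>2 + (norm w)\<^sup>2"
        unfolding m_def w
        by (subst norm_add_Pythagorean) (simp_all add: orthogonal_def cvec_simps inner_imaginary_unit)
      then have "norm w \<le> norm m" by (simp add: power2_le_imp_le)
      then show ?thesis using a by (intro mult_left_mono) auto
    qed
    finally have "norm m \<le> a * norm u \<or> norm m = 0"
      by (auto simp: power2_eq_square mult.left_commute[of "norm u"] mult.left_commute[of a]
          mult.commute[of "norm u"] mult_le_cancel_left)
    then show ?thesis unfolding u m_def using a by (auto simp: cvec_simps)
  qed
  ultimately interpret almost_orthogonal_planes Q im_proj a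
    using proj(1) orthogonal_projector_im_proj im_proj_half a by unfold_locales auto
  have "rho A = r"
    unfolding rho_def[abs_def] r_def[abs_def] p_def[abs_def] q_def[abs_def] Let_def
    by (simp add: sq_dist_real_plane sq_dist_eq_projector[OF proj(2,3)])
  then show ?thesis using r_sublevel_pseudoconvex[OF \<epsilon>] by simp
qed

theorem lemma3p3:
  "\<exists>\<delta>>0. \<forall>A :: real ^ 2 ^ 2.
     ((\<exists>a d. A = vector [vector [a, 0], vector [0, d]]) \<or>
      (\<exists>a d. A = vector [vector [a, - d], vector [d, a]] \<and> d \<noteq> 0 \<and> a\<^sup>2 + (1 - d\<^sup>2)\<^sup>2 \<noteq> 0) \<or>
      (\<exists>a d. A = vector [vector [a, d], vector [0, a]] \<and> d \<noteq> 0)) \<longrightarrow>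
     (\<forall>i j. \<bar>A $ i $ j\<bar> < \<delta>) \<longrightarrow>
     (\<forall>\<epsilon>>0. strongly_Levi_pseudoconvex_sublevel (rho A) \<epsilon>)"
proof (intro exI[of _ "1 / 100 :: real"] conjI allI impI)
  fix A :: "real ^ 2 ^ 2" and \<epsilon> :: real
  assume entries: "\<forall>i j. \<bar>A $ i $ j\<bar> < 1 / 100" and \<epsilon>: "0 < \<epsilon>"
  \<comment> \<open>four entries below \<open>1/100\<close> keep the operator norm below \<open>1/25\<close>\<close>
  have "onorm ((*v) A) \<le> real CARD(2) * real CARD(2) * (1 / 100)"
    using entries by (intro onorm_le_matrix_component) (auto intro: less_imp_le)
  then have on: "onorm ((*v) A) \<le> 1 / 25" by simp
  have "norm (A *v w) \<le> 1 / 25 * norm w" for w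
    using onorm[OF matrix_vector_mul_bounded_linear, of A w] mult_right_mono[OF on, of "norm w"]
    by simp
  then show "strongly_Levi_pseudoconvex_sublevel (rho A) \<epsilon>"
    using \<epsilon> by (intro rho_pseudoconvex[of A "1 / 25"]) auto
qed simp

end
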